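(* Suppose a negative curve in $T$ is defined by a polynomial $f(x,y)\in k[x^{\pm1},y^{\pm1}]$ vanishing at $e=(1,1)$ to order $m>0$ and supported in a triangle $\Delta\subset\mathbb{R}^2$ such that (a) $\Delta$ contains at least $\binom{m+1}{2}+1$ lattice points and has area $\le \frac{m^2}{2}$; (b) $\Delta$ has two integral vertices $(0,0)$ and $(m,h)$, where $m$ and $h$ are relatively prime, and a possibly nonintegral vertex $(r,s)$ with $0<r<m$. Then the negative curve is isomorphic to the negative curve supported in $IT(M,N)$ (with vanishing order $M+N$) or in $RT(M,N)$ (with $M>0$ and vanishing order $M$) for some integers $M,N\ge 0$, $K\ge 3$ satisfying $(M+N)^2=KMN+1$.
   Context: $k$ is an algebraically closed field of characteristic $0$, $T=\mathbb{G}_m^2$ is the two-dimensional torus over $k$ with coordinate ring $k[x^{\pm1},y^{\pm1}]$, and $e=(1,1)\in T$. A polynomial vanishes to order $m$ at $e$ if all its partial derivatives of order at most $m-1$ vanish at $e$. A polynomial is supported in a triangle $\Delta\subset\mathbb{R}^2$ if its Newton polygon is contained in $\Delta$. Lattice points are points of $\mathbb{Z}^2$. A negative curve in $T$ is a curve defined by an irreducible $f\in k[x^{\pm1},y^{\pm1}]$ that vanishes to some order $m>0$ at $e$ and whose Newton polygon is contained in some triangle of area $\le m^2/2$. For integers $M,N\ge 0$, $K\ge 3$ with $(M+N)^2=KMN+1$, $IT(M,N)$ is the (possibly degenerate) triangle with vertices $(0,0),(M+N,KN),(M,0)$ and $RT(M,N)$ is the triangle with vertices $(0,0),(M,M+N),\left(M-\frac{M+N}{K},0\right)$.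 Each $IT(M,N)$ supports, up to a nonzero constant multiple, exactly one polynomial vanishing to order $M+N$ at $e$, and each $RT(M,N)$ with $M>0$ supports, up to a nonzero constant multiple, exactly one polynomial vanishing to order $M$ at $e$; these polynomials are irreducible and define negative curves, called the negative curves supported in these triangles. Two negative curves in $T$ are isomorphic if some automorphism of $T$ carries one to the other; here automorphisms of $T$ are those given by affine linear automorphisms of the exponent lattice $\mathbb{Z}^2$. *)

theory Defs
  imports
    "HOL-Analysis.Analysis"
    "HOL-Library.Poly_Mapping"
    "HOL-Computational_Algebra.Computational_Algebra"
begin

text \<open>
  The Laurent polynomial ring in \<open>x, y\<close> is the group ring of the exponent lattice: the key
  \<open>(a, b)\<close> stands for the monomial \<open>x\<^sup>a y\<^sup>b\<close>, so multiplication, units and irreducibility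
  are those of the library's ring structure on finitely supported functions.
\<close>

type_synonym 'k laurent = "(int \<times> int) \<Rightarrow>\<^sub>0 'k"

definition torus :: "('k::field \<times> 'k) set" where
  "torus = {(x, y). x \<noteq> 0 \<and> y \<noteq> 0}"

definition monomial_at :: "int \<times> int \<Rightarrow> 'k::field \<times> 'k \<Rightarrow> 'k" where
  "monomial_at u p = (fst p powi fst u) * (snd p powi snd u)"

definition eval_at :: "'k::field laurent \<Rightarrow> 'k \<times> 'k \<Rightarrow> 'k" where
  "eval_at f p = (\<Sum>u \<in> Poly_Mapping.keys f. Poly_Mapping.lookup f u * monomial_at u p)"

definition curve :: "'k::field laurent \<Rightarrow> ('k \<times> 'k) set" where
  "curve f = {p \<in> torus. eval_at f p = 0}"

definition partial_x :: "'k::field laurent \<Rightarrow> 'k laurent" where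
  "partial_x f = (\<Sum>(a, b) \<in> Poly_Mapping.keys f.
     Poly_Mapping.single (a - 1, b) (of_int a * Poly_Mapping.lookup f (a, b)))"

definition partial_y :: "'k::field laurent \<Rightarrow> 'k laurent" where
  "partial_y f = (\<Sum>(a, b) \<in> Poly_Mapping.keys f.
     Poly_Mapping.single (a, b - 1) (of_int b * Poly_Mapping.lookup f (a, b)))"

text \<open>Order at least \<open>m\<close>: the partial derivatives of order \<open>\<le> m - 1\<close> vanish at \<open>e\<close>.\<close>

definition vanishes_to_order :: "nat \<Rightarrow> 'k::field laurent \<Rightarrow> bool" where
  "vanishes_to_order m f \<longleftrightarrow>
     (\<forall>i j. i + j < m \<longrightarrow> eval_at ((partial_x ^^ i) ((partial_y ^^ j) f)) (1, 1) = 0)"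

definition newton_polygon :: "'k::zero laurent \<Rightarrow> (real \<times> real) set" where
  "newton_polygon f = convex hull ((\<lambda>(a, b). (real_of_int a, real_of_int b)) ` Poly_Mapping.keys f)"

text \<open>Degenerate triangles (segments and points) are included.\<close>

definition plane_triangle :: "real \<times> real \<Rightarrow> real \<times> real \<Rightarrow> real \<times> real \<Rightarrow> (real \<times> real) set" where
  "plane_triangle P Q R = convex hull {P, Q, R}"

definition area :: "(real \<times> real) set \<Rightarrow> real" where
  "area S = measure lborel S"

definition lattice_points :: "(real \<times> real) set" where
  "lattice_points = \<int> \<times> \<int>"

definition supported_in :: "'k::zero laurent \<Rightarrow> (real \<times> real) set \<Rightarrow> bool" where
  "supported_in f \<Delta> \<longleftrightarrow> newton_polygon f \<subseteq> \<Delta>"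

definition defines_negative_curve :: "'k::field laurent \<Rightarrow> bool" where
  "defines_negative_curve f \<longleftrightarrow> irreducible f \<and>
     (\<exists>m P Q R. m > 0 \<and> vanishes_to_order m f \<and>
        supported_in f (plane_triangle P Q R) \<and> area (plane_triangle P Q R) \<le> (real m)\<^sup>2 / 2)"

definition negative_curve_in ::
  "(real \<times> real) set \<Rightarrow> nat \<Rightarrow> ('k::field \<times> 'k) set \<Rightarrow> bool" where
  "negative_curve_in \<Delta> m C \<longleftrightarrow>
     (\<exists>g. defines_negative_curve g \<and> vanishes_to_order m g \<and> supported_in g \<Delta> \<and> C = curve g)"

definition IT :: "nat \<Rightarrow> nat \<Rightarrow> nat \<Rightarrow> (real \<times> real) set" where
  "IT M N K = plane_triangle (0, 0) (real M + real N, real K * real N) (real M, 0)"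

definition RT :: "nat \<Rightarrow> nat \<Rightarrow> nat \<Rightarrow> (real \<times> real) set" where
  "RT M N K = plane_triangle (0, 0) (real M, real M + real N)
                (real M - (real M + real N) / real K, 0)"

definition lattice_affine_aut :: "(int \<times> int \<Rightarrow> int \<times> int) \<Rightarrow> bool" where
  "lattice_affine_aut \<phi> \<longleftrightarrow>
     (\<exists>A b. (\<forall>u v. A (u + v) = A u + A v) \<and> bij A \<and> \<phi> = (\<lambda>u. A u + b))"

text \<open>
  The automorphism of the torus given by \<open>\<phi>\<close> pulls the character \<open>u\<close> back to \<open>\<phi> u - \<phi> 0\<close>.
  The translation part of \<open>\<phi>\<close> only multiplies equations of curves by a monomial, a unit of
  the coordinate ring, so it acts trivially on points.
\<close>

definition torus_aut :: "(int \<times> int \<Rightarrow> int \<times> int) \<Rightarrow> 'k::field \<times> 'k \<Rightarrow> 'k \<times> 'k" where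
  "torus_aut \<phi> p = (monomial_at (\<phi> (1, 0) - \<phi> (0, 0)) p, monomial_at (\<phi> (0, 1) - \<phi> (0, 0)) p)"

definition isomorphic_curves :: "('k::field \<times> 'k) set \<Rightarrow> ('k \<times> 'k) set \<Rightarrow> bool" where
  "isomorphic_curves C D \<longleftrightarrow> (\<exists>\<phi>. lattice_affine_aut \<phi> \<and> torus_aut \<phi> ` C = D)"

end

theory Submission
  imports Defs
begin

text \<open>
  The coefficients of the polynomial play no role: only the lattice points of the triangle matter.
  After a reflection the third vertex lies below the edge from \<open>(0, 0)\<close> to \<open>(m, h)\<close>. Let \<open>e i\<close> be
  the lowest lattice point of the triangle in the column \<open>x = i\<close>, for \<open>0 \<le> i \<le> m\<close>. As \<open>m\<close> and \<open>h\<close> are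
  coprime, the number of lattice points is determined by the sum of the \<open>e i\<close>, and the hypothesis on
  this number says that the area above the polygonal line through the points \<open>(i, e i)\<close> is at least
  \<open>(m\<^sup>2 - 1) / 2\<close>. The area of the triangle is at most \<open>m\<^sup>2 / 2\<close>, and this small difference forces \<open>e\<close>
  to be convex. Its first and last slopes are integers; a shear makes the first one \<open>0\<close>, and the last
  one becomes \<open>K\<close>. So all lattice points lie in the triangle with vertices \<open>(0, 0)\<close>, \<open>(m, h)\<close>,
  \<open>(m - h / K, 0)\<close> for the sheared \<open>h\<close>. Write \<open>h = K q + c\<close> with \<open>0 \<le> c < K\<close> and
  \<open>D = h\<^sup>2 - K m h + K m\<^sup>2\<close>. The two estimates become \<open>c (K - c) + D \<le> K\<close> and \<open>D \<ge> 0\<close>, whence either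
  \<open>c = 0\<close> and \<open>D = K\<close>, which gives \<open>IT (m - q) q\<close>, or \<open>D = 1\<close>, which gives \<open>RT m (h - m)\<close>.
\<close>

section \<open>Area of plane triangles\<close>

text \<open>Transfers the area formula \<open>content_triangle\<close>, which is about
  \<open>real^2\<close>, to pairs. The coordinate map matches boxes with boxes of the same sides,
  and the measure of boxes determines Lebesgue measure.\<close>

lemma distr_lborel_vec2_pair:
  "distr lborel borel (\<lambda>v :: real^2. (v $ 1, v $ 2)) = (lborel :: (real \<times> real) measure)"
proof (rule lborel_eqI[symmetric])
  let ?f = "\<lambda>v :: real^2. (v $ 1, v $ 2)"
  have [measurable]: "?f \<in> borel_measurable borel"
    by (intro borel_measurable_continuous_onI continuous_intros)
  fix l u :: "real \<times> real"
  assume *: "\<And>b. b \<in> Basis \<Longrightarrow> l \<bullet> b \<le> u \<bullet> b"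
  have le: "fst l \<le> fst u" "snd l \<le> snd u"
    using *[of "(1, 0)"] *[of "(0, 1)"] by (auto simp: Basis_prod_def inner_prod_def)
  have "?f -` box l u = box (vector [fst l, snd l]) (vector [fst u, snd u])"
    by (auto simp: box_def Basis_prod_def inner_prod_def Basis_vec_def forall_2 inner_axis)
  then have "emeasure (distr lborel borel ?f) (box l u) =
      emeasure lborel (box (vector [fst l, snd l]) (vector [fst u, snd u]) :: (real^2) set)"
    by (simp add: emeasure_distr)
  also have "\<dots> = (\<Prod>b\<in>Basis. (vector [fst u, snd u] - vector [fst l, snd l] :: real^2) \<bullet> b)"
  proof (intro emeasure_lborel_box)
    fix b :: "real^2" assume "b \<in> Basis"
    then consider "b = axis 1 1" | "b = axis 2 1"
      by (auto simp: Basis_vec_def) (metis exhaust_2)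
    then show "vector [fst l, snd l] \<bullet> b \<le> vector [fst u, snd u] \<bullet> b"
      using le by cases (simp_all add: inner_axis)
  qed
  also have "\<dots> = (\<Prod>b\<in>Basis. (u - l) \<bullet> b)"
    by (simp add: Basis_vec_def Basis_prod_def inner_prod_def UNIV_2 inner_axis axis_eq_axis)
  finally show "emeasure (distr lborel borel ?f) (box l u) = (\<Prod>b\<in>Basis. (u - l) \<bullet> b)" .
qed simp

lemma area_plane_triangle:
  "area (plane_triangle (a1, a2) (b1, b2) (c1, c2)) =
     \<bar>(c1 - a1) * (b2 - a2) - (b1 - a1) * (c2 - a2)\<bar> / 2"
proof -
  let ?f = "\<lambda>v :: real^2. (v $ 1, v $ 2)"
  let ?T = "convex hull {vector [a1, a2], vector [b1, b2], vector [c1, c2]} :: (real^2) set"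
  have lin: "linear ?f"
    by (intro linearI) auto
  have [measurable]: "?f \<in> borel_measurable borel"
    by (intro borel_measurable_continuous_onI continuous_intros)
  have inj: "inj ?f"
    by (auto simp: inj_def vec_eq_iff forall_2)
  have T: "plane_triangle (a1, a2) (b1, b2) (c1, c2) = ?f ` ?T"
    by (simp add: plane_triangle_def convex_hull_linear_image[OF lin])
  have cl: "plane_triangle (a1, a2) (b1, b2) (c1, c2) \<in> sets borel"
    unfolding plane_triangle_def by (intro borel_closed compact_imp_closed finite_imp_compact_convex_hull) auto
  have "area (plane_triangle (a1, a2) (b1, b2) (c1, c2)) =
      measure (distr lborel borel ?f) (plane_triangle (a1, a2) (b1, b2) (c1, c2))"
    unfolding area_def distr_lborel_vec2_pair ..
  also have "\<dots> = measure lborel (?f -` plane_triangle (a1, a2) (b1, b2) (c1, c2))"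
    using cl by (subst measure_distr) auto
  also have "\<dots> = measure lborel ?T"
    unfolding T using inj by (simp add: inj_vimage_image_eq)
  finally show ?thesis
    by (simp add: content_triangle)
qed

section \<open>Automorphisms of the exponent lattice\<close>

abbreviation lookup where "lookup \<equiv> Poly_Mapping.lookup"

lemma Sum_any_bij:
  assumes "bij A" shows "Sum_any (\<lambda>x. g (A x)) = Sum_any g"
  using assms by (intro Sum_any.reindex_cong[symmetric]) (auto simp: bij_def fun_eq_iff)

lemma lookup_map_key:
  "inj A \<Longrightarrow> lookup (Poly_Mapping.map_key A f) u = lookup f (A u)"
  by (simp add: Poly_Mapping.map_key.rep_eq)

text \<open>The product is a convolution. Both summation indices are reindexed by \<open>A\<close>,
  and additivity with injectivity reduces \<open>A k = A l + A q\<close> to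
  \<open>k = l + q\<close>.\<close>

lemma map_key_mult:
  fixes f g :: "('a::monoid_add) \<Rightarrow>\<^sub>0 'b::semiring_0"
  assumes "bij A" and add: "\<And>u v. A (u + v) = A u + A v"
  shows "Poly_Mapping.map_key A (f * g) = Poly_Mapping.map_key A f * Poly_Mapping.map_key A g"
proof (rule poly_mapping_eqI)
  fix k
  have inj: "inj A" using assms by (simp add: bij_def)
  have eq: "A k = A l + A q \<longleftrightarrow> k = l + q" for l q
    using inj by (metis add injD)
  show "lookup (Poly_Mapping.map_key A (f * g)) k =
      lookup (Poly_Mapping.map_key A f * Poly_Mapping.map_key A g) k"
    unfolding lookup_map_key[OF inj] lookup_mult 
    by (subst Sum_any_bij[OF assms(1), symmetric], subst Sum_any_bij[OF assms(1), symmetric])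
      (simp add: eq)
qed

text \<open>\<open>map_key A\<close> is a semiring automorphism with inverse
  \<open>map_key (inv A)\<close>, so it respects units and factorizations.\<close>

lemma irreducible_map_key:
  fixes f :: "('a::comm_monoid_add) \<Rightarrow>\<^sub>0 'b::comm_semiring_1" and A :: "'a \<Rightarrow> 'a"
  assumes "bij A" and add: "\<And>u v. A (u + v) = A u + A v" and "irreducible f"
  shows "irreducible (Poly_Mapping.map_key A f)"
proof -
  let ?M = "Poly_Mapping.map_key A"
  let ?N = "Poly_Mapping.map_key (inv A)"
  have inv: "A (inv A u) = u" "inv A (A u) = u" for u
    using assms(1) by (simp_all add: bij_is_surj bij_is_inj surj_f_inv_f)
  have inj: "inj A" and bij': "bij (inv A)"
    using assms(1) by (simp_all add: bij_is_inj bij_imp_bij_inv)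
  then have inj': "inj (inv A)" by (simp add: bij_is_inj)
  have add': "inv A (u + v) = inv A u + inv A v" for u v
    using add[of "inv A u" "inv A v"] by (metis inv)
  have NM: "?N (?M p) = p" "?M (?N p) = p" for p :: "'a \<Rightarrow>\<^sub>0 'b"
    by (auto intro!: poly_mapping_eqI simp: lookup_map_key inj inj' inv)
  \<comment> \<open>The exponents are only assumed to form a monoid, so \<open>A 0 = 0\<close> is
    drawn from surjectivity of \<open>A\<close> instead of cancellation.\<close>
  have "A 0 = A 0 + A (inv A 0)" by (simp add: inv)
  also have "\<dots> = A (0 + inv A 0)" by (rule add[symmetric])
  also have "\<dots> = 0" by (simp add: inv)
  finally have A0: "A 0 = 0" .
  then have A0': "inv A 0 = 0" using inv(2)[of 0] by simp
  have M1: "?M (1 :: 'a \<Rightarrow>\<^sub>0 'b) = 1" "?N (1 :: 'a \<Rightarrow>\<^sub>0 'b) = 1"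
    using Poly_Mapping.map_key_single[OF inj, of 0 "1 :: 'b"]
      Poly_Mapping.map_key_single[OF inj', of 0 "1 :: 'b"]
    by (simp_all add: A0 A0')
  have mult: "?M (p * q) = ?M p * ?M q" "?N (p * q) = ?N p * ?N q" for p q :: "'a \<Rightarrow>\<^sub>0 'b"
    using map_key_mult[OF assms(1) add] map_key_mult[OF bij' add'] by auto
  have dvd: "?M p dvd 1 \<longleftrightarrow> p dvd 1" for p :: "'a \<Rightarrow>\<^sub>0 'b"
  proof
    assume "?M p dvd 1"
    then obtain q where "1 = ?M p * q" by (rule dvdE)
    then have "?N 1 = ?N (?M p * q)" by simp
    then show "p dvd 1" unfolding mult M1 NM by (rule dvdI)
  next
    assume "p dvd 1"
    then obtain q where "1 = p * q" by (rule dvdE)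
    then have "?M 1 = ?M (p * q)" by simp
    then show "?M p dvd 1" unfolding mult M1 by (rule dvdI)
  qed
  show ?thesis
  proof (rule irreducibleI)
    have "?N (0 :: 'a \<Rightarrow>\<^sub>0 'b) = 0"
      by (rule poly_mapping_eqI) (simp add: lookup_map_key inj')
    then show "?M f \<noteq> 0"
      using assms(3) NM(1)[of f] by (metis not_irreducible_zero)
    show "\<not> ?M f dvd 1" using assms(3) dvd by (simp add: irreducible_def)
    fix a b assume "?M f = a * b"
    then have "f = ?N a * ?N b" using NM(1)[of f] by (simp add: mult)
    with assms(3) have "?N a dvd 1 \<or> ?N b dvd 1" by (rule irreducibleD)
    then show "a dvd 1 \<or> b dvd 1" using dvd[of "?N a"] dvd[of "?N b"] by (simp add: NM)
  qed
qed

section \<open>Characters and curves under torus automorphisms\<close>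

lemma monomial_at_add:
  "p \<in> torus \<Longrightarrow> monomial_at (u + v) p = monomial_at u p * monomial_at v p"
  by (auto simp: torus_def monomial_at_def power_int_add)

lemma monomial_at_nonzero: "p \<in> torus \<Longrightarrow> monomial_at u p \<noteq> 0"
  by (auto simp: torus_def monomial_at_def)

lemma monomial_at_scale:
  "monomial_at (a * fst u, a * snd u) p = monomial_at u p powi a"
  by (simp add: monomial_at_def power_int_mult_distrib power_int_mult mult.commute[of a])

lemma additive_int_pair:
  fixes A :: "int \<times> int \<Rightarrow> int \<times> int"
  assumes add: "\<And>u v. A (u + v) = A u + A v"
  shows "A (a, b) = (a * fst (A (1, 0)) + b * fst (A (0, 1)), a * snd (A (1, 0)) + b * snd (A (0, 1)))"
proof -
  interpret Modules.additive A by unfold_locales (fact add)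
  have nat: "A (int n * x, int n * y) = (int n * fst (A (x, y)), int n * snd (A (x, y)))" for n x y
  proof (induction n)
    case 0
    show ?case using zero by (simp add: zero_prod_def)
  next
    case (Suc n)
    have "A (int (Suc n) * x, int (Suc n) * y) = A ((int n * x, int n * y) + (x, y))"
      by (simp add: algebra_simps)
    then show ?case unfolding add Suc by (simp add: prod_eq_iff algebra_simps)
  qed
  have scale: "A (c * x, c * y) = (c * fst (A (x, y)), c * snd (A (x, y)))" for c x y
  proof (cases "c \<ge> 0")
    case True
    then show ?thesis using nat[of "nat c"] by simp
  next
    case False
    have "A (c * x, c * y) = - A (int (nat (- c)) * x, int (nat (- c)) * y)"
      using False by (simp flip: minus)
    then show ?thesis using False unfolding nat by simp
  qed
  have "A (a, b) = A (a * 1, a * 0) + A (b * 0, b * 1)" by (simp flip: add)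
  then show ?thesis unfolding scale by simp
qed

lemma torus_aut_in_torus: "p \<in> torus \<Longrightarrow> torus_aut A p \<in> torus"
  using monomial_at_nonzero[of p] by (auto simp: torus_aut_def torus_def)

text \<open>\<open>torus_aut A\<close> is defined by its effect on the two coordinate characters;
  characters turn sums of exponents into products, which settles all other exponents.\<close>

lemma monomial_at_torus_aut:
  assumes add: "\<And>u v. A (u + v) = A u + A v" and p: "p \<in> torus"
  shows "monomial_at u (torus_aut A p) = monomial_at (A u) p"
proof -
  interpret Modules.additive A by unfold_locales (fact add)
  obtain a b where u: "u = (a, b)" by fastforce
  have A0: "A (0, 0) = 0" using zero by (simp add: zero_prod_def)
  have "A u = (a * fst (A (1, 0)), a * snd (A (1, 0))) + (b * fst (A (0, 1)), b * snd (A (0, 1)))"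
    using additive_int_pair[of A a b, OF add] by (simp add: u)
  then have "monomial_at (A u) p = monomial_at (A (1, 0)) p powi a * monomial_at (A (0, 1)) p powi b"
    by (simp only: monomial_at_add[OF p] monomial_at_scale)
  then show ?thesis by (simp add: u torus_aut_def A0 monomial_at_def[of "(a, b)"])
qed

lemma eval_at_Sum_any: "eval_at f p = (\<Sum>u. lookup f u * monomial_at u p)"
  unfolding eval_at_def
  by (rule Sum_any.expand_superset[symmetric]) (auto simp: in_keys_iff)

text \<open>\<open>map_key A\<close> moves the coefficient of \<open>A u\<close> to
  \<open>u\<close>, and the character \<open>u\<close> at the image point is the character
  \<open>A u\<close> at \<open>p\<close>. The two sums differ by reindexing along
  \<open>A\<close>.\<close>

lemma eval_at_map_key:
  assumes "bij A" and add: "\<And>u v. A (u + v) = A u + A v" and p: "p \<in> torus"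
  shows "eval_at (Poly_Mapping.map_key A f) (torus_aut A p) = eval_at f p"
proof -
  have "inj A" using assms by (simp add: bij_def)
  then show ?thesis
    unfolding eval_at_Sum_any monomial_at_torus_aut[OF add p]
    using Sum_any_bij[OF assms(1), of "\<lambda>u. lookup f u * monomial_at u p"]
    by (simp add: lookup_map_key)
qed

text \<open>Passing from exponents to points is contravariant, so it is \<open>B\<close> after
  \<open>A\<close> that has to be the identity on exponents.\<close>

lemma torus_aut_compose:
  assumes "\<And>u v. A (u + v) = A u + A v" "\<And>u v. B (u + v) = B u + B v" "p \<in> torus"
    and "\<And>u. B (A u) = u"
  shows "torus_aut A (torus_aut B p) = p"
proof -
  have A0: "A (0, 0) = 0" "B (0, 0) = 0"
    using assms(1,2)[of 0 0] by (simp_all add: zero_prod_def)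
  have "torus_aut A (torus_aut B p) = (monomial_at (1, 0) p, monomial_at (0, 1) p)"
    using monomial_at_torus_aut[OF assms(2,3)] by (simp add: torus_aut_def[of A] A0 assms(4))
  then show ?thesis by (simp add: monomial_at_def)
qed

lemma torus_aut_image_curve:
  assumes bij: "bij A" and add: "\<And>u v. A (u + v) = A u + A v"
  shows "torus_aut A ` curve f = curve (Poly_Mapping.map_key A f)"
proof -
  have add': "inv A (u + v) = inv A u + inv A v" for u v
    by (metis add bij bij_inv_eq_iff)
  have inv: "A (inv A u) = u" "inv A (A u) = u" for u
    using bij by (auto simp: bij_is_surj bij_is_inj surj_f_inv_f)
  show ?thesis
  proof (intro equalityI subsetI)
    fix q assume "q \<in> torus_aut A ` curve f"
    then show "q \<in> curve (Poly_Mapping.map_key A f)"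
      by (auto simp: curve_def torus_aut_in_torus eval_at_map_key[OF bij add])
  next
    fix q assume q: "q \<in> curve (Poly_Mapping.map_key A f)"
    let ?p = "torus_aut (inv A) q"
    have "?p \<in> torus" using q by (auto simp: curve_def torus_aut_in_torus)
    moreover have A: "torus_aut A ?p = q"
      using q by (intro torus_aut_compose add add') (auto simp: curve_def inv)
    moreover have "eval_at f ?p = 0"
      using eval_at_map_key[OF bij add \<open>?p \<in> torus\<close>, of f] q by (simp add: A curve_def)
    ultimately show "q \<in> torus_aut A ` curve f"
      by (intro image_eqI[of _ _ ?p]) (simp_all add: curve_def)
  qed
qed

section \<open>Order of vanishing\<close>

lemma lookup_partial_x: "lookup (partial_x f) (a, b) = of_int (a + 1) * lookup f (a + 1, b)"
proof -
  have "lookup (partial_x f) (a, b) =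
      (\<Sum>u\<in>Poly_Mapping.keys f. (of_int (fst u) * lookup f u when (fst u - 1, snd u) = (a, b)))"
    by (simp add: partial_x_def lookup_sum lookup_single case_prod_unfold)
  also have "\<dots> = (\<Sum>u\<in>Poly_Mapping.keys f. if u = (a + 1, b) then of_int (a + 1) * lookup f (a + 1, b) else 0)"
    by (intro sum.cong) (auto simp: when_def)
  also have "\<dots> = of_int (a + 1) * lookup f (a + 1, b)"
    by (auto simp: in_keys_iff)
  finally show ?thesis .
qed

lemma lookup_partial_y: "lookup (partial_y f) (a, b) = of_int (b + 1) * lookup f (a, b + 1)"
proof -
  have "lookup (partial_y f) (a, b) =
      (\<Sum>u\<in>Poly_Mapping.keys f. (of_int (snd u) * lookup f u when (fst u, snd u - 1) = (a, b)))"
    by (simp add: partial_y_def lookup_sum lookup_single case_prod_unfold)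
  also have "\<dots> = (\<Sum>u\<in>Poly_Mapping.keys f. if u = (a, b + 1) then of_int (b + 1) * lookup f (a, b + 1) else 0)"
    by (intro sum.cong) (auto simp: when_def)
  also have "\<dots> = of_int (b + 1) * lookup f (a, b + 1)"
    by (auto simp: in_keys_iff)
  finally show ?thesis .
qed

lemma partial_x_partial_y_commute: "partial_x (partial_y f) = partial_y (partial_x f)"
  by (rule poly_mapping_eqI) (auto simp: lookup_partial_x lookup_partial_y mult.left_commute)

lemma partial_y_funpow_partial_x: "(partial_y ^^ j) (partial_x f) = partial_x ((partial_y ^^ j) f)"
  by (induction j) (simp_all add: partial_x_partial_y_commute)

text \<open>Brings the order of vanishing into a recursive form on first derivatives, which can be
  compared with \<open>euler_order\<close>.\<close>

lemma vanishes_to_order_Suc: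
  "vanishes_to_order (Suc m) f \<longleftrightarrow>
     eval_at f (1, 1) = 0 \<and> vanishes_to_order m (partial_x f) \<and> vanishes_to_order m (partial_y f)"
proof (intro iffI conjI)
  assume *: "vanishes_to_order (Suc m) f"
  then have **: "i + j < Suc m \<Longrightarrow> eval_at ((partial_x ^^ i) ((partial_y ^^ j) f)) (1, 1) = 0" for i j
    by (auto simp: vanishes_to_order_def)
  show "eval_at f (1, 1) = 0" using **[of 0 0] by simp
  show "vanishes_to_order m (partial_x f)"
    unfolding vanishes_to_order_def
  proof (intro allI impI)
    fix i j assume "i + j < m"
    then show "eval_at ((partial_x ^^ i) ((partial_y ^^ j) (partial_x f))) (1, 1) = 0"
      using **[of "Suc i" j] by (simp add: partial_y_funpow_partial_x funpow_swap1)
  qed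
  show "vanishes_to_order m (partial_y f)"
    unfolding vanishes_to_order_def
  proof (intro allI impI)
    fix i j assume "i + j < m"
    then show "eval_at ((partial_x ^^ i) ((partial_y ^^ j) (partial_y f))) (1, 1) = 0"
      using **[of i "Suc j"] by (simp add: funpow_swap1)
  qed
next
  assume *: "eval_at f (1, 1) = 0 \<and> vanishes_to_order m (partial_x f) \<and> vanishes_to_order m (partial_y f)"
  show "vanishes_to_order (Suc m) f"
    unfolding vanishes_to_order_def
  proof (intro allI impI)
    fix i j assume ij: "i + j < Suc m"
    show "eval_at ((partial_x ^^ i) ((partial_y ^^ j) f)) (1, 1) = 0"
    proof (cases i)
      case (Suc i')
      then have "(partial_x ^^ i) ((partial_y ^^ j) f) = (partial_x ^^ i') ((partial_y ^^ j) (partial_x f))"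
        by (simp add: partial_y_funpow_partial_x funpow_swap1)
      then show ?thesis using * ij Suc by (auto simp: vanishes_to_order_def)
    next
      case 0
      show ?thesis
      proof (cases j)
        case (Suc j')
        have "vanishes_to_order m (partial_y f)" using * by simp
        then have "i + j' < m \<longrightarrow> eval_at ((partial_x ^^ i) ((partial_y ^^ j') (partial_y f))) (1, 1) = 0"
          unfolding vanishes_to_order_def by blast
        then show ?thesis using ij 0 Suc by (simp add: funpow_swap1)
      qed (use * 0 in simp)
    qed
  qed
qed

section \<open>Euler operators and invariance of the order\<close>

text \<open>The Euler operators \<open>x \<partial>/\<partial>x\<close> and \<open>y \<partial>/\<partial>y\<close>, whose span is invariant under linear changes of
  the exponents, unlike that of the partial derivatives.\<close>

lift_definition euler :: "(int \<times> int \<Rightarrow> 'k) \<Rightarrow> 'k::field laurent \<Rightarrow> 'k laurent"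
  is "\<lambda>w f u. w u * f u"
proof -
  fix w :: "int \<times> int \<Rightarrow> 'k" and f :: "int \<times> int \<Rightarrow> 'k" assume "finite {u. f u \<noteq> 0}"
  then show "finite {u. w u * f u \<noteq> 0}" by (rule rev_finite_subset) auto
qed

abbreviation "euler_x \<equiv> euler (\<lambda>u. of_int (fst u))"
abbreviation "euler_y \<equiv> euler (\<lambda>u. of_int (snd u))"

fun euler_order :: "nat \<Rightarrow> 'k::field laurent \<Rightarrow> bool" where
  "euler_order 0 f \<longleftrightarrow> True"
| "euler_order (Suc m) f \<longleftrightarrow>
     eval_at f (1, 1) = 0 \<and> euler_order m (euler_x f) \<and> euler_order m (euler_y f)"

lemma eval_at_one: "eval_at f (1, 1) = Sum_any (lookup f)"
  by (simp add: eval_at_Sum_any monomial_at_def)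

lemma Sum_any_lookup_add: "Sum_any (lookup (f + g)) = Sum_any (lookup f) + Sum_any (lookup g)"
  unfolding lookup_add by (rule Sum_any.distrib) auto

lemma Sum_any_lookup_euler_const: "Sum_any (lookup (euler (\<lambda>_. c) f)) = c * Sum_any (lookup f)"
  unfolding euler.rep_eq by (rule Sum_any_right_distrib[symmetric]) auto

lemma euler_add: "euler w (f + g) = euler w f + euler w g"
  by (rule poly_mapping_eqI) (simp add: euler.rep_eq lookup_add algebra_simps)

lemma euler_commute: "euler w (euler v f) = euler v (euler w f)"
  by (rule poly_mapping_eqI) (simp add: euler.rep_eq algebra_simps)

lemma euler_order_add: "euler_order m f \<Longrightarrow> euler_order m g \<Longrightarrow> euler_order m (f + g)"
  by (induction m arbitrary: f g) (auto simp: eval_at_one Sum_any_lookup_add euler_add)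

lemma euler_order_const: "euler_order m f \<Longrightarrow> euler_order m (euler (\<lambda>_. c) f)"
  by (induction m arbitrary: f)
    (auto simp: eval_at_one Sum_any_lookup_euler_const euler_commute[of _ "\<lambda>_. c"])

lemma euler_order_antimono: "euler_order (Suc m) f \<Longrightarrow> euler_order m f"
proof (induction m arbitrary: f)
  case (Suc m)
  then have "eval_at f (1, 1) = 0" "euler_order (Suc m) (euler_x f)" "euler_order (Suc m) (euler_y f)"
    by (simp_all only: euler_order.simps(2)[of "Suc m"])
  then show ?case
    unfolding euler_order.simps(2)[of m f] by (intro conjI Suc.IH)
qed simp

text \<open>Transport along \<open>A\<close> turns an Euler operator into a combination of Euler
  operators and a constant. The inverse \<open>B\<close> is allowed to be affine so that linear maps
  and translations are treated at once.\<close>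

lemma euler_order_map_key:
  assumes "bij A" and BA: "\<And>u. B (A u) = u"
    and B: "\<And>u. B u = B0 u + t" and add: "\<And>u v. B0 (u + v) = B0 u + B0 v"
    and "euler_order m f"
  shows "euler_order m (Poly_Mapping.map_key A f)"
  using assms(5)
proof (induction m arbitrary: f)
  case (Suc m)
  have inj: "inj A" using assms(1) by (simp add: bij_def)
  have *: "euler_order m (euler w (Poly_Mapping.map_key A f))"
    if "w = (\<lambda>u. of_int (fst u)) \<or> w = (\<lambda>u. of_int (snd u))" for w
  proof -
    \<comment> \<open>The coordinates of \<open>B u\<close> are affine in \<open>u\<close>; at
      \<open>A u\<close> in place of \<open>u\<close> this expresses those of \<open>u\<close>
      through those of \<open>A u\<close>.\<close>
    obtain p q c where w: "w (B u) = of_int p * of_int (fst u) + of_int q * of_int (snd u) + of_int c" for u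
    proof (cases "w = (\<lambda>u. of_int (fst u))")
      case True
      then have "w (B u) = of_int (fst (B0 (1, 0))) * of_int (fst u) + of_int (fst (B0 (0, 1))) * of_int (snd u) +
          of_int (fst t)" for u
        using additive_int_pair[of B0 "fst u" "snd u", OF add] by (simp add: B mult.commute)
      then show ?thesis by (rule that)
    next
      case False
      with \<open>w = _ \<or> w = _\<close> have "w (B u) = of_int (snd (B0 (1, 0))) * of_int (fst u) +
          of_int (snd (B0 (0, 1))) * of_int (snd u) + of_int (snd t)" for u
        using additive_int_pair[of B0 "fst u" "snd u", OF add] by (auto simp: B mult.commute)
      then show ?thesis by (rule that)
    qed
    have "w u = of_int p * of_int (fst (A u)) + of_int q * of_int (snd (A u)) + of_int c" for u
      using w[of "A u"] by (simp add: BA)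
    then have "euler w (Poly_Mapping.map_key A f) = Poly_Mapping.map_key A
        (euler (\<lambda>_. of_int p) (euler_x f) + euler (\<lambda>_. of_int q) (euler_y f) + euler (\<lambda>_. of_int c) f)"
      by (intro poly_mapping_eqI)
        (simp add: euler.rep_eq lookup_map_key[OF inj] lookup_add algebra_simps)
    moreover have "euler_order m f" using Suc.prems by (rule euler_order_antimono)
    ultimately show ?thesis
      using Suc.prems by (auto intro!: Suc.IH euler_order_add euler_order_const)
  qed
  have "Sum_any (lookup (Poly_Mapping.map_key A f)) = Sum_any (lookup f)"
    unfolding lookup_map_key[OF inj] using Sum_any_bij[OF assms(1), of "lookup f"] by simp
  then show ?case using Suc.prems * by (simp add: eval_at_one)
qed simp

text \<open>Multiplying by a monomial keeps the order at the unit point. Partial derivatives are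
  Euler operators up to such a shift of exponents.\<close>

lemma euler_order_shift_iff:
  "euler_order m (Poly_Mapping.map_key (\<lambda>u. u + t) f) \<longleftrightarrow> euler_order m f"
proof -
  have bij: "bij (\<lambda>u :: int \<times> int. u + s)" for s
    by (rule bij_betw_byWitness[where f' = "\<lambda>u. u - s"]) auto
  have shift: "euler_order m (Poly_Mapping.map_key (\<lambda>u. u + s) g)" if "euler_order m g"
    for s and g :: "'a laurent"
    by (rule euler_order_map_key[where B = "\<lambda>u. u - s" and ?B0.0 = "\<lambda>u. u" and t = "- s", OF bij])
      (use that in simp_all)
  have "euler_order m f" if "euler_order m (Poly_Mapping.map_key (\<lambda>u. u + t) f)"
  proof -
    have "Poly_Mapping.map_key (\<lambda>u. u + (- t)) (Poly_Mapping.map_key (\<lambda>u. u + t) f) = f"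
      using bij_is_inj[OF bij] by (intro poly_mapping_eqI) (simp add: lookup_map_key)
    with shift[OF that, of "- t"] show ?thesis by simp
  qed
  then show ?thesis using shift by blast
qed

lemma vanishes_to_order_iff_euler_order: "vanishes_to_order m f \<longleftrightarrow> euler_order m f"
proof (induction m arbitrary: f)
  case 0
  show ?case by (simp add: vanishes_to_order_def)
next
  case (Suc m)
  have inj: "inj (\<lambda>u :: int \<times> int. u + s)" for s by (rule injI) simp
  have "partial_x f = Poly_Mapping.map_key (\<lambda>u. u + (1, 0)) (euler_x f)"
    "partial_y f = Poly_Mapping.map_key (\<lambda>u. u + (0, 1)) (euler_y f)"
    by (auto intro!: poly_mapping_eqI simp: lookup_map_key[OF inj] euler.rep_eq lookup_partial_x lookup_partial_y)
  then show ?case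
    by (simp add: vanishes_to_order_Suc Suc.IH euler_order_shift_iff)
qed

lemma vanishes_to_order_map_key:
  assumes "bij A" and add: "\<And>u v. A (u + v) = A u + A v" and "vanishes_to_order m f"
  shows "vanishes_to_order m (Poly_Mapping.map_key A f)"
proof -
  have "inv A (u + v) = inv A u + inv A v" for u v
    by (metis add assms(1) bij_inv_eq_iff)
  then show ?thesis
    using assms unfolding vanishes_to_order_iff_euler_order
    by (intro euler_order_map_key[where B = "inv A" and ?B0.0 = "inv A" and t = 0]) (auto simp: bij_is_inj)
qed

section \<open>Lattice points counted by columns\<close>

text \<open>Pair \<open>i\<close> with \<open>m - i\<close>: by coprimality neither quotient is
  exact, so the two floors add up to \<open>h - 1\<close>.\<close>

lemma sum_floor_multiples:
  fixes m :: nat and h :: int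
  assumes "coprime (int m) h" "m > 0"
  shows "2 * (\<Sum>i\<in>{1..<m}. int i * h div int m) = (int m - 1) * (h - 1)"
proof -
  let ?g = "\<lambda>i. int i * h div int m"
  have pair: "?g i + ?g (m - i) = h - 1" if "i \<in> {1..<m}" for i
  proof -
    have "\<not> int m dvd int i * h"
    proof
      assume "int m dvd int i * h"
      then have "int m dvd int i" using assms(1) by (simp add: coprime_dvd_mult_left_iff)
      then show False using that by (auto dest!: zdvd_imp_le)
    qed
    then have "(- (int i * h)) div int m = - ?g i - 1"
      using assms(2) by (simp add: zdiv_zminus1_eq_if dvd_eq_mod_eq_0)
    moreover have "int (m - i) * h = - (int i * h) + h * int m"
      using that by (simp add: of_nat_diff algebra_simps)
    then have "?g (m - i) = h + (- (int i * h)) div int m"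
      using assms(2) by (simp only: div_mult_self1 of_nat_eq_0_iff)
    ultimately show ?thesis by simp
  qed
  have "(\<Sum>i\<in>{1..<m}. ?g i) = (\<Sum>i\<in>{1..<m}. ?g (m - i))"
    by (rule sum.reindex_bij_witness[of _ "\<lambda>i. m - i" "\<lambda>i. m - i"]) auto
  then have "2 * (\<Sum>i\<in>{1..<m}. ?g i) = (\<Sum>i\<in>{1..<m}. ?g i + ?g (m - i))"
    by (simp add: sum.distrib)
  also have "\<dots> = (\<Sum>i\<in>{1..<m}. h - 1)" by (rule sum.cong[OF refl pair])
  also have "\<dots> = (int m - 1) * (h - 1)" using assms(2) by (simp add: of_nat_diff)
  finally show ?thesis .
qed

text \<open>Two arithmetic progressions, summed by one induction up to \<open>p\<close> and another
  beyond it. They are the heights of the two lower edges in the interior columns.\<close>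

lemma sum_two_linear_pieces:
  fixes \<beta> \<gamma> h :: real
  assumes "p < m"
  shows "2 * (\<Sum>i\<in>{1..<m}. if i \<le> p then \<beta> * real i else h - \<gamma> * (real m - real i)) =
    \<beta> * p * (p + 1) + 2 * (real m - 1 - p) * h - \<gamma> * (real m - 1 - p) * (real m - p)"
proof -
  let ?L = "\<lambda>i. if i \<le> p then \<beta> * real i else h - \<gamma> * (real m - real i)"
  have 1: "2 * (\<Sum>i\<in>{1..<Suc n}. ?L i) = \<beta> * n * (n + 1)" if "n \<le> p" for n
    using that by (induction n) (auto simp: algebra_simps)
  have "2 * (\<Sum>i\<in>{1..<Suc p + n}. ?L i) = \<beta> * p * (p + 1) +
      2 * n * (h - \<gamma> * m) + \<gamma> * ((real p + n) * (real p + n + 1) - real p * (real p + 1))" for n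
    by (induction n) (use 1[of p] in \<open>auto simp: algebra_simps\<close>)
  from this[of "m - Suc p"] assms show ?thesis
    by (simp add: of_nat_diff algebra_simps)
qed

text \<open>The lower edges are recorded by their slopes, \<open>\<beta>\<close> at
  \<open>(0, 0)\<close> and \<open>\<gamma>\<close> at \<open>(m, h)\<close>; the third vertex is
  where they meet. The long upper edge is an integer inequality.\<close>

definition lattice_triangle :: "nat \<Rightarrow> int \<Rightarrow> real \<Rightarrow> real \<Rightarrow> (int \<times> int) set" where
  "lattice_triangle m h \<beta> \<gamma> = {(i, j). 0 \<le> i \<and> i \<le> int m \<and> int m * j \<le> h * i \<and>
     \<beta> * real_of_int i \<le> real_of_int j \<and> h - \<gamma> * (real m - real_of_int i) \<le> real_of_int j}"

definition lower_boundary :: "nat \<Rightarrow> int \<Rightarrow> real \<Rightarrow> real \<Rightarrow> nat \<Rightarrow> real" where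
  "lower_boundary m h \<beta> \<gamma> i = max (\<beta> * real i) (h - \<gamma> * (real m - real i))"

text \<open>Counts by columns: one point in each end column, and at most the floor of
  \<open>i * h / m\<close> minus \<open>e i\<close> plus 1 in column \<open>i\<close> between them.
  The floors have a known sum, so many lattice points force a small sum of the
  \<open>e i\<close>.\<close>

lemma sum_lower_lattice_points_le:
  fixes m :: nat and h :: int and \<beta> \<gamma> r :: real
  defines "e \<equiv> \<lambda>i. \<lceil>lower_boundary m h \<beta> \<gamma> i\<rceil>"
  assumes "0 < r" "r < m" and h: "h = \<beta> * r + \<gamma> * (m - r)" and "\<beta> \<le> \<gamma>"
    and cop: "coprime (int m) h"
    and card: "card (lattice_triangle m h \<beta> \<gamma>) \<ge> ((m + 1) choose 2) + 1"
  shows "2 * (\<Sum>i\<in>{1..<m}. e i) \<le> int m * h - h + 1 - (int m)\<^sup>2"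
proof -
  let ?W = "lattice_triangle m h \<beta> \<gamma>"
  let ?u = "\<lambda>i. int i * h div int m"
  let ?C = "\<lambda>i. (\<lambda>j. (int i, j)) ` {e i..?u i}"
  have m: "m > 0" using assms(2,3) by simp
  have hi: "real_of_int h - \<gamma> * m \<le> 0" "\<beta> * m \<le> h"
  proof -
    have "h - \<gamma> * m = - (r * (\<gamma> - \<beta>))" "\<beta> * m = h - (m - r) * (\<gamma> - \<beta>)"
      by (simp_all add: h algebra_simps)
    moreover have "r * (\<gamma> - \<beta>) \<ge> 0" "(m - r) * (\<gamma> - \<beta>) \<ge> 0"
      using assms(2,3,5) by simp_all
    ultimately show "real_of_int h - \<gamma> * m \<le> 0" "\<beta> * m \<le> h" by simp_all
  qed
  have e0: "e 0 = 0" "e m = h"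
    using hi by (simp_all add: e_def lower_boundary_def max_def)
  \<comment> \<open>A column may be empty, but its length formula never becomes negative, so the
    truncation by \<open>nat\<close> below is exact.\<close>
  have e_le: "e i \<le> ?u i + 1" if "i \<in> {1..<m}" for i
  proof -
    have "lower_boundary m h \<beta> \<gamma> i \<le> real i * h / m"
    proof -
      have "\<beta> * m * i \<le> real_of_int h * i" using hi by (intro mult_right_mono) auto
      moreover have "(h - \<gamma> * m) * (m - real i) \<le> 0"
        using hi that by (intro mult_nonpos_nonneg) auto
      then have "(h - \<gamma> * (m - real i)) * m \<le> i * h" by (simp add: algebra_simps)
      ultimately show ?thesis using m by (simp add: lower_boundary_def field_simps)
    qed
    also have "\<dots> \<le> real_of_int (?u i + 1)"
      using m floor_divide_of_int_eq[of "int i * h" "int m", where ?'a = real]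
      by (simp add: le_floor_iff) linarith
    finally show ?thesis by (simp add: e_def ceiling_le_iff)
  qed
  have "?W \<subseteq> (\<Union>i\<in>{..m}. ?C i)"
  proof
    fix w assume "w \<in> ?W"
    then obtain i j where w: "w = (int i, j)" "i \<le> m" "int m * j \<le> h * int i"
      "\<beta> * real i \<le> j" "h - \<gamma> * (real m - real i) \<le> j"
      by (auto simp: lattice_triangle_def elim!: nonneg_int_cases)
    have "int m * j div int m \<le> ?u i"
      using m w(3) by (intro zdiv_mono1) (simp_all add: mult.commute)
    then have "j \<le> ?u i" using m by simp
    moreover have "e i \<le> j" using w by (simp add: e_def lower_boundary_def ceiling_le_iff)
    ultimately show "w \<in> (\<Union>i\<in>{..m}. ?C i)" using w by (intro UN_I[of i]) auto
  qed
  then have "card ?W \<le> card (\<Union>i\<in>{..m}. ?C i)" by (intro card_mono) auto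
  also have "\<dots> \<le> (\<Sum>i\<in>{..m}. card (?C i))" by (rule card_UN_le) simp
  also have "\<dots> = (\<Sum>i\<in>{..m}. nat (?u i - e i + 1))"
    by (intro sum.cong refl) (simp add: card_image inj_on_def)
  also have "{..m} = insert 0 (insert m {1..<m})" using m by auto
  also have "(\<Sum>i\<in>\<dots>. nat (?u i - e i + 1)) = 2 + (\<Sum>i\<in>{1..<m}. nat (?u i - e i + 1))"
    using m e0 by simp
  finally have "int (card ?W) \<le> 2 + int (\<Sum>i\<in>{1..<m}. nat (?u i - e i + 1))" by linarith
  also have "int (\<Sum>i\<in>{1..<m}. nat (?u i - e i + 1)) = (\<Sum>i\<in>{1..<m}. ?u i - e i + 1)"
    unfolding of_nat_sum using e_le by (intro sum.cong) force+
  also have "\<dots> = (\<Sum>i\<in>{1..<m}. ?u i) - (\<Sum>i\<in>{1..<m}. e i) + (int m - 1)"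
    using m by (simp add: sum.distrib sum_subtractf of_nat_diff)
  finally have "2 * int (card ?W) \<le>
      2 * (2 + ((\<Sum>i\<in>{1..<m}. ?u i) - (\<Sum>i\<in>{1..<m}. e i) + (int m - 1)))"
    by (rule mult_left_mono) simp
  also have "\<dots> = 4 + (int m - 1) * (h - 1) - 2 * (\<Sum>i\<in>{1..<m}. e i) + 2 * (int m - 1)"
    unfolding sum_floor_multiples[OF cop m, symmetric] by (simp add: distrib_left right_diff_distrib)
  finally have "2 * int (card ?W) \<le> 4 + (int m - 1) * (h - 1) - 2 * (\<Sum>i\<in>{1..<m}. e i) + 2 * (int m - 1)" .
  moreover have "2 * int ((m + 1) choose 2) = int m * (int m + 1)"
  proof -
    have "2 * ((m + 1) choose 2) = m * (m + 1)" by (simp add: choose_two)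
    then have "int (2 * ((m + 1) choose 2)) = int (m * (m + 1))" by simp
    then show ?thesis by (simp add: algebra_simps)
  qed
  ultimately show ?thesis using card
    by (simp add: algebra_simps power2_eq_square)
qed

section \<open>Convexity of the lowest lattice points\<close>

text \<open>The trapezoid sum of the boundary exceeds its integral by the corner term \<open>(\<gamma> - \<beta>) t (1 - t)\<close>,
  where \<open>t\<close> is the fractional part of \<open>r\<close>. The area bound therefore leaves a total slack of at most
  \<open>1\<close> for twice the roundings \<open>e i - L i\<close>, and a failure of convexity at \<open>i\<close> uses all of it in
  column \<open>i\<close>. Then the third vertex is integral and twice the area is \<open>m\<^sup>2\<close>, against coprimality.\<close>

lemma lower_lattice_points_convex:
  fixes m :: nat and h :: int and \<beta> \<gamma> r :: real
  defines "e \<equiv> \<lambda>i. \<lceil>lower_boundary m h \<beta> \<gamma> i\<rceil>"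
  assumes m: "m \<ge> 2" and r: "0 < r" "r < m" and h: "h = \<beta> * r + \<gamma> * (m - r)" and "\<beta> \<le> \<gamma>"
    and area: "r * (m - r) * (\<gamma> - \<beta>) \<le> m\<^sup>2" and cop: "coprime (int m) h"
    and sum_e: "2 * (\<Sum>i\<in>{1..<m}. e i) \<le> int m * h - h + 1 - (int m)\<^sup>2"
    and i: "i \<in> {1..<m}"
  shows "2 * e i \<le> e (i - 1) + e (i + 1)"
proof (rule ccontr)
  assume nconv: "\<not> 2 * e i \<le> e (i - 1) + e (i + 1)"
  define L where "L = lower_boundary m h \<beta> \<gamma>"
  define x where "x = (\<lambda>i. e i - L i)"
  define p where "p = nat \<lfloor>r\<rfloor>"
  define t where "t = r - p"
  have p: "real p \<le> r" "r < p + 1" "p < m" using r unfolding p_def by linarith+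
  have L_if: "L i = (if i \<le> p then \<beta> * real i else h - \<gamma> * (real m - real i))" for i
  proof -
    have "h - \<gamma> * (real m - real i) - \<beta> * real i = (\<gamma> - \<beta>) * (i - r)"
      by (simp add: h algebra_simps)
    moreover have "(\<gamma> - \<beta>) * (i - r) \<le> 0" if "i \<le> p"
      using that p \<open>\<beta> \<le> \<gamma>\<close> by (intro mult_nonneg_nonpos) auto
    moreover have "(\<gamma> - \<beta>) * (i - r) \<ge> 0" if "\<not> i \<le> p"
      using that p \<open>\<beta> \<le> \<gamma>\<close> by (intro mult_nonneg_nonneg) auto
    ultimately show ?thesis by (auto simp: L_def lower_boundary_def)
  qed
  have x0: "x i \<ge> 0" for i by (simp add: x_def e_def L_def)
  have "2 * (\<Sum>i\<in>{1..<m}. L i) = m * h - h - r * (m - r) * (\<gamma> - \<beta>) + (\<gamma> - \<beta>) * t * (1 - t)"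
    unfolding L_if sum_two_linear_pieces[OF p(3)] by (simp add: h t_def algebra_simps)
  moreover have "2 * real_of_int (\<Sum>i\<in>{1..<m}. e i) \<le> m * h - h + 1 - m\<^sup>2"
  proof -
    have "real_of_int (2 * (\<Sum>i\<in>{1..<m}. e i)) \<le> real_of_int (int m * h - h + 1 - (int m)\<^sup>2)"
      using sum_e by (simp only: of_int_le_iff)
    then show ?thesis by simp
  qed
  ultimately have sum_x: "2 * (\<Sum>i\<in>{1..<m}. x i) \<le>
      1 - (m\<^sup>2 - r * (m - r) * (\<gamma> - \<beta>)) - (\<gamma> - \<beta>) * t * (1 - t)"
    by (simp add: x_def sum_subtractf)
  have t: "0 \<le> t" "t < 1" using p by (simp_all add: t_def)
  then have corner: "(\<gamma> - \<beta>) * t * (1 - t) \<ge> 0" using \<open>\<beta> \<le> \<gamma>\<close> by simp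
  \<comment> \<open>Equal slopes would flatten the triangle to a segment: the slack becomes
    \<open>1 - m\<^sup>2 < 0\<close>, although all roundings are nonnegative.\<close>
  have "\<beta> < \<gamma>"
  proof (rule ccontr)
    assume "\<not> \<beta> < \<gamma>"
    then have "\<beta> = \<gamma>" using \<open>\<beta> \<le> \<gamma>\<close> by simp
    then have "2 * (\<Sum>i\<in>{1..<m}. x i) \<le> 1 - (real m)\<^sup>2" using sum_x by simp
    moreover have "(real m)\<^sup>2 \<ge> 2\<^sup>2" using m by (intro power_mono) auto
    moreover have "(\<Sum>i\<in>{1..<m}. x i) \<ge> 0" using x0 by (intro sum_nonneg) auto
    ultimately show False by simp
  qed
  have sum_x': "2 * (x i + (\<Sum>i\<in>{1..<m} - {i}. x i)) \<le> 
      1 - (m\<^sup>2 - r * (m - r) * (\<gamma> - \<beta>)) - (\<gamma> - \<beta>) * t * (1 - t)"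
    using sum_x i by (simp add: sum.remove[of _ i])
  have rest: "(\<Sum>i\<in>{1..<m} - {i}. x i) \<ge> 0" using x0 by (intro sum_nonneg) auto
  \<comment> \<open>Integrality turns the failure of convexity into an excess of at least 1;
    rounding in the neighbouring columns only enlarges \<open>x i\<close>.\<close>
  have "2 * e i \<ge> e (i - 1) + e (i + 1) + 1" using nconv by simp
  then have ei: "2 * real_of_int (e i) \<ge> e (i - 1) + e (i + 1) + 1" by linarith
  have Lconv: "L (i - 1) + L (i + 1) \<ge> 2 * L i"
    using i by (auto simp: L_def lower_boundary_def of_nat_diff max_def algebra_simps)
  have xi: "2 * x i \<ge> 1 + (L (i - 1) + L (i + 1) - 2 * L i)"
    using ei x0[of "i - 1"] x0[of "i + 1"] by (simp add: x_def)
  \<comment> \<open>The slack of 1 is spent on column \<open>i\<close> alone, so every other term of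
    the estimate is zero.\<close>
  have squeeze: "c = 0 \<and> a = M \<and> s = 0 \<and> l = 0"
    if "2 * y \<ge> 1 + l" "l \<ge> 0" "s \<ge> 0" "2 * (y + s) \<le> 1 - (M - a) - c" "c \<ge> 0" "a \<le> M"
    for y l s M a c :: real
    using that by auto
  have "(\<gamma> - \<beta>) * t * (1 - t) = 0" and A: "r * (m - r) * (\<gamma> - \<beta>) = m\<^sup>2"
    and others: "(\<Sum>i\<in>{1..<m} - {i}. x i) = 0" and Lflat: "L (i - 1) + L (i + 1) = 2 * L i"
    using squeeze[OF xi _ rest sum_x' corner area] Lconv by auto
  then have "t = 0" using t \<open>\<beta> < \<gamma>\<close> by simp
  then have rp: "r = p" by (simp add: t_def)
  then have p1: "p \<in> {1..<m}" using r by auto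
  \<comment> \<open>At the corner \<open>p\<close> the second difference of \<open>L\<close> is
    \<open>\<gamma> - \<beta> > 0\<close>, whereas \<open>L\<close> is flat at \<open>i\<close>.
    Hence column \<open>p\<close> is among the others and has no rounding.\<close>
  have "i \<noteq> p"
  proof
    assume "i = p"
    have "L (p - 1) + L (p + 1) - 2 * L p = \<gamma> - \<beta>"
      using p1 by (simp add: L_if h rp of_nat_diff algebra_simps)
    then show False using Lflat \<open>i = p\<close> \<open>\<beta> < \<gamma>\<close> by simp
  qed
  then have "x p = 0" using others x0 p1 by (simp add: sum_nonneg_eq_0_iff)
  then have "e p = \<beta> * p" by (simp add: x_def L_if)
  then have "real_of_int (h * int p - int m * e p) = real_of_int ((int m)\<^sup>2)"
    using A by (simp add: h rp algebra_simps)
  then have "h * int p - int m * e p = (int m)\<^sup>2" by (simp only: of_int_eq_iff)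
  then have "h * int p = int m * (e p + int m)" by (simp add: algebra_simps power2_eq_square)
  then have "int m dvd h * int p" by simp
  then have "int m dvd int p" using cop by (simp add: coprime_dvd_mult_right_iff)
  then show False using p1 by (auto dest!: zdvd_imp_le)
qed

text \<open>The increments increase, so the sequence stays above the lines extending its first and
  its last step.\<close>

lemma convex_sequence_bounds:
  fixes e :: "nat \<Rightarrow> int"
  assumes conv: "\<And>i. i \<in> {1..<m} \<Longrightarrow> 2 * e i \<le> e (i - 1) + e (i + 1)" and "i \<le> m" "m \<ge> 1"
  shows "e i \<ge> e 0 + int i * (e 1 - e 0)" "e i \<ge> e m - int (m - i) * (e m - e (m - 1))"
    "e 1 - e 0 \<le> e m - e (m - 1)"
proof -
  define d where "d = (\<lambda>i. e (Suc i) - e i)"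
  have step: "d i \<le> d (Suc i)" if "Suc i < m" for i
    using conv[of "Suc i"] that by (simp add: d_def)
  have mono: "d i \<le> d j" if "i \<le> j" "j < m" for i j
    using that by (induction j rule: dec_induct) (use step in force)+
  show "e i \<ge> e 0 + int i * (e 1 - e 0)"
    using \<open>i \<le> m\<close>
  proof (induction i)
    case (Suc i)
    then show ?case using mono[of 0 i] by (simp add: d_def algebra_simps)
  qed simp
  have "e (m - k) \<ge> e m - int k * (e m - e (m - 1))" if "k \<le> m" for k
    using that
  proof (induction k)
    case (Suc k)
    then have "Suc (m - Suc k) = m - k" by simp
    moreover have "d (m - Suc k) \<le> d (m - 1)" using Suc.prems by (intro mono) auto
    ultimately show ?case using Suc \<open>m \<ge> 1\<close> by (simp add: d_def algebra_simps)
  qed simp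
  from this[of "m - i"] \<open>i \<le> m\<close> show "e i \<ge> e m - int (m - i) * (e m - e (m - 1))" by simp
  show "e 1 - e 0 \<le> e m - e (m - 1)" using mono[of 0 "m - 1"] \<open>m \<ge> 1\<close> by (simp add: d_def)
qed

section \<open>The shape of the lattice triangle\<close>

text \<open>With \<open>K \<le> 2\<close> the equation would give
  \<open>M\<^sup>2 + N\<^sup>2 \<le> 1\<close>.\<close>

lemma square_eq_imp_ge_3:
  fixes K M N :: int
  assumes "(M + N)\<^sup>2 = K * M * N + 1" "M \<ge> 1" "N \<ge> 1"
  shows "K \<ge> 3"
proof (rule ccontr)
  assume "\<not> K \<ge> 3"
  then have "K * (M * N) \<le> 2 * (M * N)" using assms by (intro mult_right_mono) auto
  then have "M\<^sup>2 + N\<^sup>2 \<le> 1" using assms(1) by (simp add: power2_eq_square algebra_simps)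
  moreover have "M\<^sup>2 \<ge> 1" "N\<^sup>2 \<ge> 1" using assms by simp_all
  ultimately show False by linarith
qed

lemma parameters_exist:
  fixes m :: nat and h K :: int
  assumes m: "m \<ge> 2" and cop: "coprime (int m) h" and K: "K \<ge> 1" "h \<ge> 1"
    and h_le: "h \<le> K * (int m - 1)" and area: "h * (K * int m - h) \<le> K * (int m)\<^sup>2"
    and sum: "2 * (\<Sum>i\<in>{1..<m}. max 0 (h - K * (int m - int i))) \<le> (int m - 1) * h + 1 - (int m)\<^sup>2"
  shows "\<exists>M N :: nat. K \<ge> 3 \<and> (int M + int N)\<^sup>2 = K * int M * int N + 1 \<and>
    (m = M + N \<and> h = K * int N \<or> m = M \<and> h = int M + int N)"
proof -
  define q where "q = nat (h div K)"
  define c where "c = h mod K"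
  \<comment> \<open>\<open>D / K\<close> is \<open>m\<^sup>2\<close> minus twice the area of the
    triangle with vertices \<open>(0, 0)\<close>, \<open>(m, h)\<close>,
    \<open>(m - h / K, 0)\<close>.\<close>
  define D where "D = h\<^sup>2 - K * int m * h + K * (int m)\<^sup>2"
  have hq: "h = K * int q + c" using K by (simp add: q_def c_def pos_imp_zdiv_nonneg_iff)
  have c: "0 \<le> c" "c < K" using K by (simp_all add: c_def)
  have "K * int q \<le> K * (int m - 1)" using hq c h_le by linarith
  then have qm: "q < m" using K by simp
  have D0: "D \<ge> 0" using area by (simp add: D_def power2_eq_square algebra_simps)
  have D_ne: "D \<noteq> 0"
  proof
    assume "D = 0"
    then have "h * h = int m * (K * (h - int m))"
      by (simp add: D_def power2_eq_square algebra_simps)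
    then have "int m dvd h * h" by simp
    then have "int m dvd h" using cop by (simp add: coprime_dvd_mult_left_iff)
    then have "int m dvd 1" using cop by (intro coprime_common_divisor[OF cop]) simp_all
    then show False using m by simp
  qed
  have gauss: "2 * (\<Sum>k\<in>{1..n}. h - K * int k) = 2 * int n * h - K * int n * (int n + 1)" for n
    by (induction n) (simp_all add: algebra_simps)
  \<comment> \<open>Counted from the right end, columns 1 to \<open>q\<close> are those where the
    edge of slope \<open>K\<close> is on or above the base.\<close>
  have "(\<Sum>k\<in>{1..q}. h - K * int k) = (\<Sum>i\<in>{m - q..<m}. h - K * (int m - int i))"
    using qm by (intro sum.reindex_bij_witness[of _ "\<lambda>i. m - i" "\<lambda>i. m - i"]) (auto simp: of_nat_diff)
  also have "\<dots> \<le> (\<Sum>i\<in>{m - q..<m}. max 0 (h - K * (int m - int i)))"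
    by (intro sum_mono) simp
  also have "\<dots> \<le> (\<Sum>i\<in>{1..<m}. max 0 (h - K * (int m - int i)))"
    using qm by (intro sum_mono2) auto
  finally have "2 * int q * h - K * int q * (int q + 1) \<le> (int m - 1) * h + 1 - (int m)\<^sup>2"
    using sum gauss[of q] by linarith
  then have "K * (2 * int q * h - K * int q * (int q + 1)) \<le> K * ((int m - 1) * h + 1 - (int m)\<^sup>2)"
    using K by (intro mult_left_mono) auto
  moreover have "K * (2 * int q * h - K * int q * (int q + 1)) + K * h = h\<^sup>2 + c * (K - c)"
    unfolding hq by (simp add: power2_eq_square algebra_simps)
  ultimately have key: "c * (K - c) + D \<le> K" by (simp add: D_def algebra_simps)
  show ?thesis
  proof (cases "c = 0")
    case True
    define E where "E = K * (int q)\<^sup>2 - K * int m * int q + (int m)\<^sup>2"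
    have DE: "D = K * E" by (simp add: D_def E_def hq True power2_eq_square algebra_simps)
    have "E \<ge> 1" using D0 D_ne DE K by (simp add: zero_le_mult_iff)
    moreover have "E \<le> 1" using key DE True K by simp
    ultimately have "E = 1" by simp
    then have eq: "(int (m - q) + int q)\<^sup>2 = K * int (m - q) * int q + 1"
      using qm by (simp add: E_def of_nat_diff power2_eq_square algebra_simps)
    have "q \<ge> 1" using hq True K by (cases q) auto
    then have "K \<ge> 3" using square_eq_imp_ge_3[OF eq] qm by simp
    then show ?thesis using eq qm hq True by (intro exI[of _ "m - q"] exI[of _ q]) auto
  next
    case False
    \<comment> \<open>This product equals \<open>c * (K - c) - (K - 1)\<close>, so
      \<open>key\<close> leaves room only for \<open>D \<le> 1\<close>.\<close>
    then have "(c - 1) * (K - c - 1) \<ge> 0" using c by simp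
    then have "c * (K - c) \<ge> K - 1" by (simp add: algebra_simps)
    then have D1: "D = 1" using key D0 D_ne by simp
    \<comment> \<open>The sign of the right side gives \<open>h \<ge> m\<close>, which makes
      \<open>N = h - m\<close> a natural number.\<close>
    then have "K * int m * (h - int m) = h\<^sup>2 - 1"
      by (simp add: D_def power2_eq_square algebra_simps)
    moreover have "h\<^sup>2 \<ge> 1" using K by simp
    ultimately have "K * int m * (h - int m) \<ge> 0" using K by simp
    moreover have "K * int m > 0" using K m by simp
    ultimately have "h \<ge> int m" by (simp add: zero_le_mult_iff)
    moreover have "h \<noteq> int m" using cop m by auto
    ultimately have N: "h = int m + int (nat (h - int m))" "int (nat (h - int m)) \<ge> 1" by simp_all
    define N where "N = nat (h - int m)"
    have eq: "(int m + int N)\<^sup>2 = K * int m * int N + 1"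
      using D1 N(1) unfolding N_def[symmetric] D_def by (simp add: power2_eq_square algebra_simps)
    moreover have "K \<ge> 3" using square_eq_imp_ge_3[OF eq] m N(2) by (simp add: N_def)
    ultimately show ?thesis using N(1) unfolding N_def by blast
  qed
qed

lemma mem_plane_triangle_base:
  assumes "K > 0" "0 < h" "h < K * m"
    and "0 \<le> y" "h - K * (m - x) \<le> y" "m * y \<le> h * x"
  shows "(x, y) \<in> plane_triangle (0, 0) (m, h) (m - h / K, 0)"
proof -
  \<comment> \<open>Barycentric weights: \<open>v\<close> belongs to \<open>(m, h)\<close> and is
    read off from the height; \<open>w\<close> belongs to the base vertex and is proportional to
    \<open>h * x - m * y\<close>, which vanishes on the long edge. The remaining weight vanishes on
    the edge of slope \<open>K\<close>.\<close>
  define v where "v = y / h"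
  define w where "w = K * (h * x - m * y) / (h * (K * m - h))"
  have pos: "h * (K * m - h) > 0" using assms by simp
  have "v \<ge> 0" "w \<ge> 0" using assms pos by (simp_all add: v_def w_def)
  have "v + w = (y * (K * m - h) + K * (h * x - m * y)) / (h * (K * m - h))"
  proof -
    have "v = y * (K * m - h) / (h * (K * m - h))" using assms by (simp add: v_def)
    then show ?thesis by (simp add: w_def add_divide_distrib)
  qed
  also have "\<dots> = (K * x - y) / (K * m - h)"
    using assms pos by (simp add: divide_simps) (simp add: algebra_simps)
  also have "\<dots> \<le> 1" using assms by (simp add: algebra_simps)
  finally have "1 - v - w \<ge> 0" by simp
  moreover have "w * (m - h / K) = (h * x - m * y) / h"
    using assms pos by (simp add: w_def divide_simps)
  then have "x = v * m + w * (m - h / K)" using assms by (simp add: v_def diff_divide_distrib)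
  moreover have "y = v * h" using assms by (simp add: v_def)
  ultimately have "(x, y) = (1 - v - w) *\<^sub>R (0, 0) + v *\<^sub>R (m, h) + w *\<^sub>R (m - h / K, 0)" by simp
  then show ?thesis
    unfolding plane_triangle_def convex_hull_3
    using \<open>v \<ge> 0\<close> \<open>w \<ge> 0\<close> \<open>1 - v - w \<ge> 0\<close>
    by (intro CollectI exI[of _ "1 - v - w"] exI[of _ v] exI[of _ w]) auto
qed

text \<open>With slopes \<open>a\<close>, \<open>c\<close> relative to the long edge, twice the area is \<open>m\<^sup>2 a c / (a + c)\<close>, which
  is monotone in both.\<close>

lemma harmonic_bound_mono:
  fixes a c a' c' :: real
  assumes "0 < a'" "a' \<le> a" "0 < c'" "c' \<le> c" "a * c \<le> a + c"
  shows "a' * c' \<le> a' + c'"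
proof -
  have "a' * c' * (a * c) \<le> a' * c' * (a + c)" using assms by (intro mult_left_mono) auto
  also have "\<dots> \<le> (a' + c') * (a * c)"
  proof -
    have "(a' + c') * (a * c) - a' * c' * (a + c) = a' * a * (c - c') + c' * c * (a - a')"
      by (simp add: algebra_simps)
    moreover have "\<dots> \<ge> 0" using assms by simp
    ultimately show ?thesis by linarith
  qed
  finally show ?thesis using assms by (simp add: mult_le_cancel_right)
qed

lemma lattice_triangle_in_IT_or_RT:
  fixes m :: nat and h :: int and \<beta> \<gamma> r :: real
  assumes r: "0 < r" "r < m" and h: "h = \<beta> * r + \<gamma> * (m - r)" and "\<beta> \<le> \<gamma>"
    and area: "r * (m - r) * (\<gamma> - \<beta>) \<le> m\<^sup>2" and cop: "coprime (int m) h"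
    and card: "card (lattice_triangle m h \<beta> \<gamma>) \<ge> ((m + 1) choose 2) + 1"
  obtains b :: int and M N K :: nat and T where "K \<ge> 3" "(M + N)\<^sup>2 = K * M * N + 1"
    "m = M + N \<and> T = IT M N K \<or> m = M \<and> T = RT M N K"
    "\<And>i j. (i, j) \<in> lattice_triangle m h \<beta> \<gamma> \<Longrightarrow> (real_of_int i, real_of_int (j - b * i)) \<in> T"
proof -
  let ?W = "lattice_triangle m h \<beta> \<gamma>"
  have m0: "m > 0" using r by simp
  show ?thesis
  \<comment> \<open>For \<open>m = 1\<close> there are no interior columns, and the shear by
    \<open>h\<close> moves the points to the ends of a horizontal segment, the degenerate
    \<open>IT 1 0 K\<close>. The choice \<open>K = 3\<close> is arbitrary.\<close>
  proof (cases "m = 1")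
    case True
    have vertices: "(0, 0) \<in> IT 1 0 3" "(1, 0) \<in> IT 1 0 3"
      unfolding IT_def plane_triangle_def by (auto intro: hull_inc)
    have "(real_of_int i, real_of_int (j - h * i)) \<in> IT 1 0 3" if ij: "(i, j) \<in> ?W" for i j
    proof -
      have *: "0 \<le> i" "i \<le> 1" "j \<le> h * i" "\<beta> * i \<le> j" "h - \<gamma> * (1 - i) \<le> j"
        using ij True by (simp_all add: lattice_triangle_def)
      then consider "i = 0" | "i = 1" by linarith
      then show ?thesis
      proof cases
        case 1
        with * have "j = 0" by simp
        with 1 vertices show ?thesis by simp
      next
        case 2
        with * have "j = h" by simp
        with 2 vertices show ?thesis by simp
      qed
    qed
    then show ?thesis using True by (intro that[of 3 1 0 "IT 1 0 3" h]) auto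
  next
    case False
    then have m: "m \<ge> 2" using m0 by simp
    let ?L = "lower_boundary m h \<beta> \<gamma>"
    define e where "e = (\<lambda>i. \<lceil>?L i\<rceil>)"
    have sum_e: "2 * (\<Sum>i\<in>{1..<m}. e i) \<le> int m * h - h + 1 - (int m)\<^sup>2"
      unfolding e_def using r h \<open>\<beta> \<le> \<gamma>\<close> cop card by (rule sum_lower_lattice_points_le)
    have conv: "2 * e i \<le> e (i - 1) + e (i + 1)" if "i \<in> {1..<m}" for i
      using lower_lattice_points_convex[OF m r h \<open>\<beta> \<le> \<gamma>\<close> area cop] sum_e that by (simp add: e_def)
    have slopes: "h - \<gamma> * m = - (r * (\<gamma> - \<beta>))" "\<beta> * m = h - (m - r) * (\<gamma> - \<beta>)"
      by (simp_all add: h algebra_simps)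
    have nonneg: "r * (\<gamma> - \<beta>) \<ge> 0" "(m - r) * (\<gamma> - \<beta>) \<ge> 0"
      using r \<open>\<beta> \<le> \<gamma>\<close> by simp_all
    have e0: "e 0 = 0" "e m = h"
      using slopes nonneg by (simp_all add: e_def lower_boundary_def max_def)
    define b where "b = e 1"
    \<comment> \<open>The last slope of \<open>e\<close> is \<open>b + K\<close>, hence
      \<open>K\<close> after the shear by \<open>b\<close>.\<close>
    define K where "K = h - e (m - 1) - b"
    define h' where "h' = h - b * int m"
    \<comment> \<open>Rounding up never lowers the first slope and never raises the last
      one.\<close>
    have b_ge: "\<beta> \<le> b" and bK_le: "b + K \<le> \<gamma>"
    proof -
      have "\<beta> \<le> ?L 1" "h - \<gamma> \<le> ?L (m - 1)"
        using m by (simp_all add: lower_boundary_def of_nat_diff)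
      moreover have "?L 1 \<le> e 1" "?L (m - 1) \<le> e (m - 1)" by (simp_all add: e_def)
      ultimately show "\<beta> \<le> b" "b + K \<le> \<gamma>" by (simp_all add: b_def K_def)
    qed
    have lower1: "b * int i \<le> e i" and lower2: "h - (b + K) * (int m - int i) \<le> e i"
      if "i \<le> m" for i
      using convex_sequence_bounds(1,2)[of m e i, OF conv that] that m0
      by (simp_all add: e0 b_def K_def of_nat_diff mult.commute)
    have "K \<ge> 0" using convex_sequence_bounds(3)[of m e 0, OF conv] m0 by (simp add: e0 b_def K_def)
    have "h' \<ge> K" using lower1[of "m - 1"] m
      by (simp add: h'_def K_def of_nat_diff algebra_simps)
    have h'_le: "h' \<le> K * (int m - 1)" using lower2[of 1] m
      by (simp add: h'_def b_def algebra_simps)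
    have cop': "coprime (int m) h'"
    proof (rule coprimeI)
      fix d assume "d dvd int m" "d dvd h'"
      then have "d dvd h' + b * int m" by simp
      then have "d dvd h" by (simp add: h'_def)
      with cop \<open>d dvd int m\<close> show "is_unit d" by (rule coprime_common_divisor)
    qed
    have "K \<noteq> 0"
    proof
      assume "K = 0"
      then have "h' = 0" using \<open>h' \<ge> K\<close> h'_le by simp
      then show False using cop' m by simp
    qed
    then have "K \<ge> 1" "h' \<ge> 1" using \<open>K \<ge> 0\<close> \<open>h' \<ge> K\<close> by simp_all
    have "h' < K * int m" using h'_le \<open>K \<ge> 1\<close> by (simp add: algebra_simps)
    have lower: "max 0 (h' - K * (int m - int i)) + b * int i \<le> e i" if "i \<le> m" for i
      using lower1[OF that] lower2[OF that] by (simp add: h'_def max_def algebra_simps)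
    have sum': "2 * (\<Sum>i\<in>{1..<m}. max 0 (h' - K * (int m - int i))) \<le> (int m - 1) * h' + 1 - (int m)\<^sup>2"
    proof -
      have "2 * (\<Sum>i\<in>{1..<n}. b * int i) = b * int n * (int n - 1)" if "n \<ge> 1" for n
        using that by (induction n rule: nat_induct_at_least) (simp_all add: algebra_simps)
      then have "2 * (\<Sum>i\<in>{1..<m}. b * int i) = b * int m * (int m - 1)" using m0 by simp
      moreover have "(\<Sum>i\<in>{1..<m}. max 0 (h' - K * (int m - int i)) + b * int i) \<le> (\<Sum>i\<in>{1..<m}. e i)"
        using lower by (intro sum_mono) auto
      ultimately show ?thesis using sum_e by (simp add: sum.distrib h'_def algebra_simps)
    qed
    have area': "h' * (K * int m - h') \<le> K * (int m)\<^sup>2"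
    proof -
      \<comment> \<open>\<open>a\<close> and \<open>c\<close> are the slopes of the lower edges
        relative to the long edge. For the sheared triangle with lower slopes 0 and \<open>K\<close>
        they become \<open>h' / m\<close> and \<open>(K * m - h') / m\<close>, which are no larger
        by \<open>b_ge\<close> and \<open>bK_le\<close>.\<close>
      define a where "a = (\<gamma> - \<beta>) * (m - r) / m"
      define c where "c = (\<gamma> - \<beta>) * r / m"
      have ac: "a + c = \<gamma> - \<beta>" using m0 by (simp add: a_def c_def field_simps)
      have "a * c = (\<gamma> - \<beta>) * (r * (m - r) * (\<gamma> - \<beta>) / m\<^sup>2)"
        by (simp add: a_def c_def power2_eq_square)
      also have "\<dots> \<le> (\<gamma> - \<beta>) * 1"
        using area m0 \<open>\<beta> \<le> \<gamma>\<close> by (intro mult_left_mono) (simp_all add: divide_le_eq)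
      finally have "a * c \<le> a + c" by (simp add: ac)
      moreover have "h' / m \<le> a"
        using b_ge m0 slopes(2) by (simp add: a_def h'_def field_simps)
      moreover have "(K * m - h') / m \<le> c"
      proof -
        have "(b + K) * real m \<le> \<gamma> * m" using bK_le by (intro mult_right_mono) auto
        then have "K * real m - h' \<le> (\<gamma> - \<beta>) * r"
          using slopes(1) by (simp add: h'_def algebra_simps)
        then show ?thesis unfolding c_def by (intro divide_right_mono) auto
      qed
      moreover have "0 < h' / m" "0 < (K * m - h') / m"
      proof -
        have "0 < h'" "0 < K * int m - h'" using \<open>h' \<ge> 1\<close> \<open>h' < K * int m\<close> by simp_all
        then show "0 < h' / m" "0 < (K * m - h') / m"
          using m0 by (intro divide_pos_pos; simp only: of_int_0_less_iff of_nat_0_less_iff)+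
      qed
      ultimately have "h' / m * ((K * m - h') / m) \<le> h' / m + (K * m - h') / m"
        using harmonic_bound_mono[of "h' / m" a "(K * m - h') / m" c] by blast
      also have "\<dots> = K" using m0 by (simp add: field_simps)
      finally have "real_of_int (h' * (K * int m - h')) \<le> real_of_int (K * (int m)\<^sup>2)"
        using m0 by (simp add: field_simps power2_eq_square)
      then show ?thesis by (simp only: of_int_le_iff)
    qed
    obtain M N :: nat where MN: "K \<ge> 3" "(int M + int N)\<^sup>2 = K * int M * int N + 1"
      "m = M + N \<and> h' = K * int N \<or> m = M \<and> h' = int M + int N"
      using parameters_exist[OF m cop' \<open>K \<ge> 1\<close> \<open>h' \<ge> 1\<close> h'_le area' sum'] by blast
    \<comment> \<open>For \<open>h' = K * N\<close> the base vertex is \<open>(M, 0)\<close>, as in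
      \<open>IT\<close>; for \<open>m = M\<close> and \<open>h' = M + N\<close> it is the one of
      \<open>RT\<close>.\<close>
    define T where "T = plane_triangle (0, 0) (real m, real_of_int h') (m - h' / K, 0)"
    obtain k :: nat where k: "K = int k" using \<open>K \<ge> 0\<close> nonneg_int_cases by blast
    show ?thesis
    proof (rule that[of k M N T b])
      show "k \<ge> 3" using MN(1) k by simp
      have "int ((M + N)\<^sup>2) = int (k * M * N + 1)" using MN(2) k by simp
      then show "(M + N)\<^sup>2 = k * M * N + 1" by (simp only: of_nat_eq_iff)
      show "m = M + N \<and> T = IT M N k \<or> m = M \<and> T = RT M N k"
        using MN(3) \<open>K \<ge> 1\<close> by (auto simp: T_def IT_def RT_def k)
      fix i j assume ij: "(i, j) \<in> ?W"
      then obtain n where n: "i = int n" "n \<le> m"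
        by (auto simp: lattice_triangle_def elim!: nonneg_int_cases)
      have "?L n \<le> j" using ij n by (auto simp: lattice_triangle_def lower_boundary_def)
      then have "e n \<le> j" by (simp add: e_def ceiling_le_iff)
      then have "0 \<le> j - b * i" "h' - K * (int m - i) \<le> j - b * i"
        using lower[OF n(2)] by (simp_all add: n)
      moreover have "int m * (j - b * i) \<le> h' * i"
        using ij by (simp add: lattice_triangle_def h'_def algebra_simps)
      ultimately have "real_of_int 0 \<le> real_of_int (j - b * i)"
        "real_of_int (h' - K * (int m - i)) \<le> real_of_int (j - b * i)"
        "real_of_int (int m * (j - b * i)) \<le> real_of_int (h' * i)"
        by (simp_all only: of_int_le_iff)
      moreover have "real_of_int h' < real_of_int (K * int m)"
        using \<open>h' < K * int m\<close> by (simp only: of_int_less_iff)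
      ultimately show "(real_of_int i, real_of_int (j - b * i)) \<in> T"
        unfolding T_def using \<open>K \<ge> 1\<close> \<open>h' \<ge> 1\<close> by (intro mem_plane_triangle_base) simp_all
    qed
  qed
qed

section \<open>Classification of the curves\<close>

lemma finite_lattice_triangle:
  assumes "m > 0"
  shows "finite (lattice_triangle m h \<beta> \<gamma>)"
proof (rule finite_subset)
  show "lattice_triangle m h \<beta> \<gamma> \<subseteq> {0..int m} \<times> {\<lfloor>- \<bar>\<beta>\<bar> * m\<rfloor>..\<bar>h\<bar>}"
  proof (rule subrelI)
    fix i j assume ij: "(i, j) \<in> lattice_triangle m h \<beta> \<gamma>"
    then have i: "0 \<le> i" "i \<le> int m" by (simp_all add: lattice_triangle_def)
    have "int m * j \<le> h * i" using ij by (simp add: lattice_triangle_def)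
    also have "\<dots> \<le> \<bar>h\<bar> * int m" using i by (intro mult_mono) auto
    finally have "j \<le> \<bar>h\<bar>" using assms by (simp add: mult.commute)
    have "\<bar>\<beta>\<bar> * real_of_int i \<le> \<bar>\<beta>\<bar> * m" using i by (intro mult_left_mono) auto
    moreover have "- (\<bar>\<beta>\<bar> * real_of_int i) \<le> \<beta> * i"
      using i by (simp add: abs_if mult_left_mono)
    ultimately have "- \<bar>\<beta>\<bar> * m \<le> j" using ij by (auto simp: lattice_triangle_def)
    then have "\<lfloor>- \<bar>\<beta>\<bar> * m\<rfloor> \<le> j" using floor_mono by fastforce
    then show "(i, j) \<in> {0..int m} \<times> {\<lfloor>- \<bar>\<beta>\<bar> * m\<rfloor>..\<bar>h\<bar>}"
      using i \<open>j \<le> \<bar>h\<bar>\<close> by simp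
  qed
qed simp

text \<open>The sign \<open>\<sigma> = - 1\<close> stands for reflection in the horizontal axis. In
  each of the three edge inequalities, cleared of denominators, the sides differ by a barycentric
  weight times \<open>h * r - m * s\<close>, twice the area.\<close>

lemma mem_lattice_triangle:
  fixes m :: nat and h :: int and r s :: real
  assumes r: "0 < r" "r < m" and below: "m * s \<le> h * r" and \<sigma>: "\<sigma> = 1 \<or> \<sigma> = - 1"
    and ij: "(real_of_int i, real_of_int j) \<in>
      plane_triangle (0, 0) (m, real_of_int (\<sigma> * h)) (r, \<sigma> * s)"
  shows "(i, \<sigma> * j) \<in> lattice_triangle m h (s / r) ((h - s) / (m - r))"
proof -
  obtain u v w :: real where uvw: "u \<ge> 0" "v \<ge> 0" "w \<ge> 0" "u + v + w = 1"
    and ij: "real_of_int i = v * m + w * r" "real_of_int j = v * (\<sigma> * h) + w * (\<sigma> * s)"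
    using ij unfolding plane_triangle_def convex_hull_3 by auto
  define y where "y = v * h + w * s"
  have j: "real_of_int (\<sigma> * j) = y" using \<sigma> ij(2) by (auto simp: y_def algebra_simps)
  have nonneg: "w * (h * r - m * s) \<ge> 0" "v * (h * r - m * s) \<ge> 0" "u * (h * r - m * s) \<ge> 0"
    using uvw below by simp_all
  have i0: "0 \<le> real_of_int i" using uvw r by (simp add: ij)
  have "v * m + w * r \<le> v * m + w * m + u * m"
    using uvw r by (intro add_increasing2 add_mono mult_left_mono) auto
  also have "\<dots> = (u + v + w) * m" by (simp add: algebra_simps)
  also have "\<dots> = m" using uvw(4) by simp
  finally have im: "real_of_int i \<le> m" by (simp add: ij)
  have "m * y \<le> h * i"
    using nonneg(1) by (simp add: y_def ij algebra_simps)
  then have "real_of_int (int m * (\<sigma> * j)) \<le> real_of_int (h * i)"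
    using j by simp
  then have upper: "int m * (\<sigma> * j) \<le> h * i" by (simp only: of_int_le_iff)
  have "s * i \<le> y * r"
    using nonneg(2) by (simp add: y_def ij algebra_simps)
  then have left: "s / r * i \<le> y" using r by (simp add: field_simps)
  have "(m - r) * (y - h) - (h - s) * (i - m) = u * (h * r - m * s)"
  proof -
    have u: "u = 1 - v - w" using uvw(4) by simp
    show ?thesis unfolding u y_def by (simp add: ij algebra_simps)
  qed
  then have "h * (m - r) - (h - s) * (m - i) \<le> y * (m - r)"
    using nonneg(3) by (simp add: algebra_simps)
  moreover have "h - (h - s) / (m - r) * (m - i) = (h * (m - r) - (h - s) * (m - i)) / (m - r)"
    using r diff_divide_distrib[of "h * (m - r)" "(h - s) * (m - i)" "m - r"] by simp
  ultimately have right: "h - (h - s) / (m - r) * (m - i) \<le> y"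
    using r by (simp add: pos_divide_le_eq)
  show ?thesis
    unfolding lattice_triangle_def using i0 im upper left right
    by (simp add: j del: of_int_mult)
qed

lemma supported_inI:
  assumes "\<And>a b. (a, b) \<in> Poly_Mapping.keys g \<Longrightarrow> (real_of_int a, real_of_int b) \<in> plane_triangle P Q R"
  shows "supported_in g (plane_triangle P Q R)"
  unfolding supported_in_def newton_polygon_def
  using assms by (intro hull_minimal) (auto simp: plane_triangle_def)

lemma supported_inD:
  assumes "supported_in g \<Delta>" "(a, b) \<in> Poly_Mapping.keys g"
  shows "(real_of_int a, real_of_int b) \<in> \<Delta>"
proof -
  have "(real_of_int a, real_of_int b) \<in> newton_polygon g"
    unfolding newton_polygon_def using assms(2) by (intro hull_inc) (auto intro!: rev_image_eqI)
  then show ?thesis using assms(1) by (auto simp: supported_in_def)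
qed

text \<open>Twice the area is \<open>K * M * N = (M + N)\<^sup>2 - 1\<close>.\<close>

lemma area_IT_le:
  assumes "(M + N)\<^sup>2 = K * M * N + 1"
  shows "area (IT M N K) \<le> (real (M + N))\<^sup>2 / 2"
proof -
  have "real ((M + N)\<^sup>2) = real (K * M * N + 1)" using assms by (simp only:)
  then have "(real (M + N))\<^sup>2 = K * M * N + 1" by simp
  then show ?thesis unfolding IT_def area_plane_triangle by (simp add: ac_simps)
qed

text \<open>Twice the area is \<open>M\<^sup>2 - 1 / K\<close>.\<close>

lemma area_RT_le:
  assumes "(M + N)\<^sup>2 = K * M * N + 1" "K > 0" "M > 0"
  shows "area (RT M N K) \<le> (real M)\<^sup>2 / 2"
proof -
  have "real ((M + N)\<^sup>2) = real (K * M * N + 1)" using assms by (simp only:)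
  then have "(real M + real N)\<^sup>2 = real K * M * N + 1" by simp
  then have "(M - (real M + real N) / K) * (real M + real N) = (real M)\<^sup>2 - 1 / K"
    using assms(2) by (simp add: field_simps power2_eq_square)
  moreover have "(real M)\<^sup>2 \<ge> 1" "1 / real K \<le> 1" using assms(2,3) by simp_all
  ultimately show ?thesis unfolding RT_def area_plane_triangle by simp
qed

theorem theorem1p1:
  fixes f :: "'k::{alg_closed_field, field_char_0} laurent"
    and m :: nat and h :: int and r s :: real and \<Delta> :: "(real \<times> real) set"
  assumes "defines_negative_curve f"
    and "m > 0" and "vanishes_to_order m f"
    and "\<Delta> = plane_triangle (0, 0) (real m, real_of_int h) (r, s)"
    and "supported_in f \<Delta>"
    and "card (lattice_points \<inter> \<Delta>) \<ge> ((m + 1) choose 2) + 1"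
    and "area \<Delta> \<le> (real m)\<^sup>2 / 2"
    and "coprime (int m) h"
    and "0 < r" and "r < real m"
  shows "\<exists>M N K :: nat. K \<ge> 3 \<and> (M + N)\<^sup>2 = K * M * N + 1 \<and>
           (\<exists>C. (negative_curve_in (IT M N K) (M + N) C \<or>
                 M > 0 \<and> negative_curve_in (RT M N K) M C) \<and>
                isomorphic_curves (curve f) C)"
proof -
  \<comment> \<open>The reflection is applied exactly when the third vertex lies above the long
    edge.\<close>
  define \<sigma> :: int where "\<sigma> = (if m * s \<le> h * r then 1 else - 1)"
  have \<sigma>: "\<sigma> = 1 \<or> \<sigma> = - 1" and \<sigma>\<sigma>: "\<sigma> * (\<sigma> * a) = a" "\<sigma> * (\<sigma> * x) = x" for a and x :: real
    by (auto simp: \<sigma>_def)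
  define h' where "h' = \<sigma> * h"
  define s' where "s' = \<sigma> * s"
  define \<beta> where "\<beta> = s' / r"
  define \<gamma> where "\<gamma> = (h' - s') / (m - r)"
  let ?W = "lattice_triangle m h' \<beta> \<gamma>"
  have below: "m * s' \<le> h' * r" by (auto simp: h'_def s'_def \<sigma>_def)
  have in_W: "(i, \<sigma> * j) \<in> ?W" if "(real_of_int i, real_of_int j) \<in> \<Delta>" for i j
    unfolding \<beta>_def \<gamma>_def using assms(9,10) below \<sigma>
    by (rule mem_lattice_triangle) (use that in \<open>simp add: assms(4) h'_def s'_def \<sigma>\<sigma>\<close>)
  have h'_eq: "h' = \<beta> * r + \<gamma> * (m - r)" using assms(9,10) by (simp add: \<beta>_def \<gamma>_def)
  have slope_diff: "r * (m - r) * (\<gamma> - \<beta>) = h' * r - m * s'"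
  proof -
    have "s' = \<beta> * r" using assms(9) by (simp add: \<beta>_def)
    then show ?thesis by (simp add: h'_eq algebra_simps)
  qed
  have "\<beta> \<le> \<gamma>"
  proof -
    have "r * (m - r) * (\<gamma> - \<beta>) \<ge> 0" "r * (m - r) > 0"
      unfolding slope_diff using below assms(9,10) by simp_all
    then show ?thesis by (simp add: zero_le_mult_iff)
  qed
  have "area \<Delta> = \<bar>r * h - m * s\<bar> / 2" unfolding assms(4) area_plane_triangle by simp
  then have area: "r * (m - r) * (\<gamma> - \<beta>) \<le> m\<^sup>2"
    using assms(7) unfolding slope_diff
    by (auto simp: h'_def s'_def \<sigma>_def algebra_simps abs_if split: if_splits)
  have cop: "coprime (int m) h'" using assms(8) \<sigma> by (auto simp: h'_def)
  have card: "((m + 1) choose 2) + 1 \<le> card ?W"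
  proof -
    have "lattice_points \<inter> \<Delta> \<subseteq> (\<lambda>(i, j). (real_of_int i, real_of_int (\<sigma> * j))) ` ?W"
    proof
      fix p assume p: "p \<in> lattice_points \<inter> \<Delta>"
      then obtain i j where "p = (real_of_int i, real_of_int j)"
        by (auto simp: lattice_points_def elim!: Ints_cases)
      then show "p \<in> (\<lambda>(i, j). (real_of_int i, real_of_int (\<sigma> * j))) ` ?W"
        using in_W[of i j] p by (auto simp: \<sigma>\<sigma> simp del: of_int_mult intro!: rev_image_eqI)
    qed
    then have "card (lattice_points \<inter> \<Delta>) \<le> card ?W"
      by (rule surj_card_le[OF finite_lattice_triangle[OF assms(2)]])
    then show ?thesis using assms(6) by simp
  qed
  obtain b :: int and M N K :: nat and T where MNK: "K \<ge> 3" "(M + N)\<^sup>2 = K * M * N + 1"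
    and T: "m = M + N \<and> T = IT M N K \<or> m = M \<and> T = RT M N K"
    and in_T: "\<And>i j. (i, j) \<in> ?W \<Longrightarrow> (real_of_int i, real_of_int (j - b * i)) \<in> T"
    using lattice_triangle_in_IT_or_RT[OF assms(9,10) h'_eq \<open>\<beta> \<le> \<gamma>\<close> area cop card] by metis
  \<comment> \<open>\<open>map_key A\<close> puts the coefficient of \<open>A u\<close> at
    \<open>u\<close>, so \<open>A\<close> runs from \<open>T\<close> back to the exponents of
    \<open>f\<close>: it undoes the shear and then the reflection.\<close>
  define A :: "int \<times> int \<Rightarrow> int \<times> int" where "A = (\<lambda>(x, y). (x, \<sigma> * (y + b * x)))"
  have bij: "bij A"
    by (rule bij_betw_byWitness[where f' = "\<lambda>(x, y). (x, \<sigma> * y - b * x)"])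
      (use \<sigma> in \<open>auto simp: A_def\<close>)
  have add: "A (u + v) = A u + A v" for u v
    by (auto simp: A_def algebra_simps split: prod.splits)
  define g where "g = Poly_Mapping.map_key A f"
  have keys_in_T: "(real_of_int x, real_of_int y) \<in> T" if "(x, y) \<in> Poly_Mapping.keys g" for x y
  proof -
    have "A (x, y) \<in> Poly_Mapping.keys f"
      using that bij by (simp add: g_def in_keys_iff lookup_map_key bij_is_inj)
    then have "(x, \<sigma> * (y + b * x)) \<in> Poly_Mapping.keys f" by (simp add: A_def)
    then have "(x, \<sigma> * (\<sigma> * (y + b * x))) \<in> ?W" by (intro in_W supported_inD[OF assms(5)])
    from in_T[OF this] show ?thesis by (simp add: \<sigma>\<sigma>)
  qed
  obtain P Q R where PQR: "T = plane_triangle P Q R" using T unfolding IT_def RT_def by blast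
  have supp: "supported_in g T" using keys_in_T unfolding PQR by (rule supported_inI)
  have van: "vanishes_to_order m g"
    unfolding g_def using bij add assms(3) by (rule vanishes_to_order_map_key)
  \<comment> \<open>\<open>T\<close> itself, with order \<open>m\<close>, will witness that
    \<open>g\<close> defines a negative curve.\<close>
  have area_T: "area T \<le> (real m)\<^sup>2 / 2"
    using T area_IT_le[OF MNK(2)] area_RT_le[OF MNK(2)] MNK(1) assms(2) by auto
  have "irreducible g"
    unfolding g_def using bij add assms(1) by (intro irreducible_map_key) (auto simp: defines_negative_curve_def)
  then have "defines_negative_curve g"
    unfolding defines_negative_curve_def using assms(2) van supp area_T PQR by blast
  then have "negative_curve_in T m (curve g)"
    unfolding negative_curve_in_def using van supp by blast
  then have "negative_curve_in (IT M N K) (M + N) (curve g) \<or>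
      M > 0 \<and> negative_curve_in (RT M N K) M (curve g)"
    using T assms(2) by auto
  moreover have "isomorphic_curves (curve f) (curve g)"
    unfolding isomorphic_curves_def lattice_affine_aut_def
  proof (intro exI conjI allI)
    show "A (u + v) = A u + A v" for u v by (rule add)
    show "bij A" by (rule bij)
    show "A = (\<lambda>u. A u + 0)" by simp
    show "torus_aut A ` curve f = curve g"
      unfolding g_def using bij add by (rule torus_aut_image_curve)
  qed
  ultimately show ?thesis using MNK by blast
qed

end
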